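(* Let $W$ be an $n\times n$ Type 1 matrix power function with coefficient matrix $A=(a_{ij})$ and powers $\gamma_{ij}\in\mathbb{R}$. Then $W$ is an $A_2$ matrix weight if and only if $A$ is positive definite and the powers satisfy $$\gamma_{ij}=\frac{\gamma_{ii}+\gamma_{jj}}{2}\quad\text{and}\quad -1<\gamma_{ii}<1\qquad\text{for } 1\le i,j\le n.$$
   Context: Let $n\ge 1$. An $n\times n$ Type 1 matrix power function is a matrix-valued function $W$ of the real variable $x$ (defined for $x\neq 0$, hence almost everywhere on $\mathbb{R}$) whose $(i,j)$ entry is $a_{ij}|x|^{\gamma_{ij}}$, where $a_{ij}\in\mathbb{C}$ and $\gamma_{ij}\in\mathbb{R}$ for $1\le i,j\le n$. Its coefficient matrix is $A=(a_{ij})_{i,j=1}^n$. Convention: whenever $a_{ij}=0$, the entry $a_{ij}|x|^{\gamma_{ij}}$ is identically zero and the exponent $\gamma_{ij}$ is immaterial; in that case it is taken to be $\gamma_{ij}=\frac{\gamma_{ii}+\gamma_{jj}}{2}$. A complex square matrix is positive definite if it is self-adjoint with all eigenvalues (strictly) positive. A function $W:\mathbb{R}\to M_n(\mathbb{C})$ (defined a.e.) is a matrix weight if $W(x)$ is positive definite for a.e. $x\in\mathbb{R}$ and each entry of $W$ is locally integrable. For a bounded interval $I$ of positive length, $\langle W\rangle_I=\frac{1}{|I|}\int_I W(x)\,dx$, computed entrywise. A matrix weight $W$ is an $A_2$ matrix weight if the entries of $W^{-1}$ are also locally integrable and $$[W]_{A_2}=\sup_I\left\|\langle W\rangle_I^{1/2}\langle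 W^{-1}\rangle_I^{1/2}\right\|^2<\infty,$$ where the supremum is over all bounded intervals $I\subset\mathbb{R}$ of positive length, $\|\cdot\|$ is the operator norm on $\mathbb{C}^n$, and $W^{-1}(x)=W(x)^{-1}$. *)

theory Defs
  imports "HOL-Analysis.Analysis"
begin

definition conj_transpose :: "complex^'n^'n \<Rightarrow> complex^'n^'n" where
  "conj_transpose M = (\<chi> i j. cnj (M $ j $ i))"

definition self_adjoint_matrix :: "complex^'n^'n \<Rightarrow> bool" where
  "self_adjoint_matrix M \<longleftrightarrow> conj_transpose M = M"

definition matrix_eigenvalue :: "complex^'n^'n \<Rightarrow> complex \<Rightarrow> bool" where
  "matrix_eigenvalue M c \<longleftrightarrow> (\<exists>v. v \<noteq> 0 \<and> M *v v = c *s v)"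

definition positive_definite :: "complex^'n^'n \<Rightarrow> bool" where
  "positive_definite M \<longleftrightarrow>
     self_adjoint_matrix M \<and> (\<forall>c. matrix_eigenvalue M c \<longrightarrow> c \<in> \<real> \<and> 0 < Re c)"

text \<open>
  The square root is meaningful only for positive definite matrices, which have exactly one
  positive definite square root. This suffices below: the averages of a matrix weight, and of its
  inverse when that is locally integrable, are positive definite.
\<close>

definition matrix_sqrt :: "complex^'n^'n \<Rightarrow> complex^'n^'n" where
  "matrix_sqrt M = (THE B. positive_definite B \<and> B ** B = M)"

definition operator_norm :: "complex^'n^'n \<Rightarrow> real" where
  "operator_norm M = onorm ((*v) M)"

definition locally_integrable :: "(real \<Rightarrow> complex) \<Rightarrow> bool" where
  "locally_integrable f \<longleftrightarrow> (\<forall>K. compact K \<longrightarrow> f absolutely_integrable_on K)"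

text \<open>
  Functions defined almost everywhere are represented by total functions. All notions below use
  the complete measure \<^term>\<open>lebesgue\<close>, so they do not depend on the values on a null set.
\<close>

definition matrix_weight :: "(real \<Rightarrow> complex^'n^'n) \<Rightarrow> bool" where
  "matrix_weight W \<longleftrightarrow>
     (AE x in lebesgue. positive_definite (W x)) \<and>
     (\<forall>i j. locally_integrable (\<lambda>x. W x $ i $ j))"

definition bounded_intervals :: "real set set" where
  "bounded_intervals = {I. is_interval I \<and> bounded I \<and> 0 < measure lebesgue I}"

definition matrix_average :: "(real \<Rightarrow> complex^'n^'n) \<Rightarrow> real set \<Rightarrow> complex^'n^'n" where
  "matrix_average W I =
     (\<chi> i j. (LINT x:I|lebesgue. W x $ i $ j) / of_real (measure lebesgue I))"

definition A2_characteristic :: "(real \<Rightarrow> complex^'n^'n) \<Rightarrow> ennreal" where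
  "A2_characteristic W =
     (SUP I\<in>bounded_intervals.
        ennreal ((operator_norm (matrix_sqrt (matrix_average W I) **
                   matrix_sqrt (matrix_average (\<lambda>x. matrix_inv (W x)) I)))\<^sup>2))"

definition A2_matrix_weight :: "(real \<Rightarrow> complex^'n^'n) \<Rightarrow> bool" where
  "A2_matrix_weight W \<longleftrightarrow>
     matrix_weight W \<and>
     (\<forall>i j. locally_integrable (\<lambda>x. matrix_inv (W x) $ i $ j)) \<and>
     A2_characteristic W < \<infinity>"

text \<open>
  The value of \<open>W\<close> at \<open>0\<close> is left arbitrary. The second conjunct is the convention fixing the
  otherwise immaterial exponent of an identically vanishing entry.
\<close>

definition type1_matrix_power_function ::
    "complex^'n^'n \<Rightarrow> real^'n^'n \<Rightarrow> (real \<Rightarrow> complex^'n^'n) \<Rightarrow> bool" where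
  "type1_matrix_power_function A \<gamma> W \<longleftrightarrow>
     (\<forall>x. x \<noteq> 0 \<longrightarrow> (\<forall>i j. W x $ i $ j = A $ i $ j * of_real (\<bar>x\<bar> powr (\<gamma> $ i $ j)))) \<and>
     (\<forall>i j. A $ i $ j = 0 \<longrightarrow> \<gamma> $ i $ j = (\<gamma> $ i $ i + \<gamma> $ j $ j) / 2)"

end

theory Submission
  imports Defs
begin

text \<open>
  Write \<open>\<gamma>\<^sub>i\<close> for the diagonal powers. If every \<open>\<gamma> $ i $ j\<close> is the mean of \<open>\<gamma>\<^sub>i\<close> and \<open>\<gamma>\<^sub>j\<close>, then
  \<open>W x = D A D\<close> with the invertible real diagonal matrix \<open>D = diag (\<bar>x\<bar> powr (\<gamma>\<^sub>i / 2))\<close>. Positive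
  definiteness passes back and forth between \<open>A\<close> and \<open>W x\<close>, and the inverse \<open>D\<inverse> A\<inverse> D\<inverse>\<close> is
  again a power function, with coefficient matrix \<open>A\<inverse>\<close> and powers \<open>-\<gamma>\<close>.

  Sufficiency. For positive definite \<open>P\<close> and \<open>Q\<close>, the squared operator norm of
  \<open>P\<^sup>1\<^sup>/\<^sup>2 Q\<^sup>1\<^sup>/\<^sup>2\<close> is at most its squared Frobenius norm, which is \<open>trace (P Q)\<close>. Applied to the averages of
  \<open>W\<close> and of its inverse, the trace is a combination, with coefficients \<open>a\<^sub>i\<^sub>j\<close> times the \<open>(j, i)\<close> entry
  of \<open>A\<inverse>\<close>, of the products of the averages of \<open>\<bar>x\<bar> powr g\<close> and \<open>\<bar>x\<bar> powr (-g)\<close>, where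
  \<open>g = \<gamma> $ i $ j\<close> is the same in both factors. So the matrix condition reduces to the scalar one for
  the power weights with \<open>-1 < g < 1\<close> (\<open>operator_norm_sqrt_product_le\<close>,
  \<open>power_average_product_le\<close>).

  Necessity. If \<open>a\<^sub>i\<^sub>j \<noteq> 0\<close>, the inequality \<open>\<bar>M\<^sub>i\<^sub>j\<bar>\<^sup>2 \<le> M\<^sub>i\<^sub>i M\<^sub>j\<^sub>j\<close> for the positive definite
  matrix \<open>M = W x\<close> bounds \<open>\<bar>x\<bar> powr (2 * \<gamma> $ i $ j - \<gamma>\<^sub>i - \<gamma>\<^sub>j)\<close> by a constant for almost
  every \<open>x\<close>, both near \<open>0\<close> and near infinity, so this power is \<open>0\<close>
  (\<open>bounded_abs_powr_exponent_eq_0\<close>). Integrability of the diagonal of \<open>W\<close> at \<open>0\<close> gives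
  \<open>-1 < \<gamma>\<^sub>i\<close>, and since the diagonal entries of an inverse dominate the reciprocals of the diagonal
  entries (\<open>matrix_inv_diag_ge\<close>), integrability of the diagonal of the inverse gives \<open>\<gamma>\<^sub>i < 1\<close>.

  The linear algebra rests on the spectral theorem for symmetric operators on a Euclidean space.
  It is applied to \<open>complex ^ 'n\<close> with its real inner product \<open>x \<bullet> y\<close>, the real part of the
  Hermitian one; this loses nothing, because a matrix is Hermitian exactly if it is symmetric for the
  real inner product, and its Hermitian form is then real.
\<close>

section \<open>Spectral theorem and square roots of symmetric operators\<close>

text \<open>
  The form attains its minimum \<open>l\<close> on the unit sphere of \<open>S\<close> at some \<open>v\<close>. Then \<open>f - l\<close> has a nonnegative
  form that vanishes at \<open>v\<close>; its first variation at \<open>v\<close> therefore vanishes, which says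
  \<open>f v = l v\<close>.
\<close>

lemma self_adjoint_least_eigenvalue:
  fixes f :: "'a::euclidean_space \<Rightarrow> 'a"
  assumes f: "linear f" and sym: "\<And>x y. f x \<bullet> y = x \<bullet> f y"
    and S: "subspace S" "f ` S \<subseteq> S" "S \<noteq> {0}"
  obtains v l where "v \<in> S" "norm v = 1" "f v = l *\<^sub>R v" "\<And>x. x \<in> S \<Longrightarrow> l * (x \<bullet> x) \<le> f x \<bullet> x"
proof -
  have 0: "0 \<in> S" using S(1) by (rule subspace_0)
  then obtain s where s: "s \<in> S" "s \<noteq> 0" using S(3) by blast
  let ?K = "S \<inter> sphere 0 1"
  have "compact ?K" using S(1) by (simp add: closed_subspace closed_Int_compact)
  moreover have "(1 / norm s) *\<^sub>R s \<in> ?K" using s S(1) by (simp add: subspace_scale)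
  moreover have "continuous_on ?K (\<lambda>x. f x \<bullet> x)"
    by (intro continuous_intros linear_continuous_on linear_conv_bounded_linear[THEN iffD1, OF f])
  ultimately obtain v where v: "v \<in> ?K" and min: "\<And>x. x \<in> ?K \<Longrightarrow> f v \<bullet> v \<le> f x \<bullet> x"
    using continuous_attains_inf[of ?K "\<lambda>x. f x \<bullet> x"] by blast
  define l where "l = f v \<bullet> v"
  have vS: "v \<in> S" and v1: "norm v = 1" using v by auto
  have vv: "v \<bullet> v = 1" using v1 by (simp add: dot_square_norm)
  have bound: "l * (x \<bullet> x) \<le> f x \<bullet> x" if x: "x \<in> S" for x
  proof (cases "x = 0")
    case False
    have "l \<le> f ((1 / norm x) *\<^sub>R x) \<bullet> ((1 / norm x) *\<^sub>R x)"
      unfolding l_def by (rule min) (use x False S(1) in \<open>simp add: subspace_scale\<close>)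
    also have "\<dots> = (f x \<bullet> x) / (x \<bullet> x)"
      by (simp add: linear_scale[OF f] dot_square_norm power2_eq_square)
    finally show ?thesis using False by (simp add: field_simps)
  qed (simp add: linear_0[OF f])
  define w where "w = f v - l *\<^sub>R v"
  have wS: "w \<in> S" using vS S by (auto simp: w_def intro!: subspace_diff subspace_scale)
  have "w \<bullet> w = 0"
  proof (rule ccontr)
    assume "w \<bullet> w \<noteq> 0"
    then have pos: "0 < w \<bullet> w" by simp
    define c where "c = f w \<bullet> w - l * (w \<bullet> w)"
    have c0: "0 \<le> c" using bound[OF wS] by (simp add: c_def)
    have fv: "f v = w + l *\<^sub>R v" by (simp add: w_def)
    have fvw: "f v \<bullet> w = w \<bullet> w + l * (v \<bullet> w)"
      by (subst fv) (simp add: inner_simps)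
    have fwv: "f w \<bullet> v = w \<bullet> w + l * (v \<bullet> w)"
      using fvw sym[of w v] by (simp add: inner_commute[of w "f v"])
    have ineq: "0 \<le> 2 * t * (w \<bullet> w) + t\<^sup>2 * c" for t
    proof -
      have "v + t *\<^sub>R w \<in> S" using vS wS S(1) by (simp add: subspace_add subspace_scale)
      note le = bound[OF this]
      have e1: "f (v + t *\<^sub>R w) \<bullet> (v + t *\<^sub>R w) =
          l + 2 * t * (w \<bullet> w + l * (v \<bullet> w)) + t\<^sup>2 * (f w \<bullet> w)"
        using fvw fwv by (simp add: linear_add[OF f] linear_scale[OF f] inner_simps
            power2_eq_square l_def algebra_simps)
      have e2: "(v + t *\<^sub>R w) \<bullet> (v + t *\<^sub>R w) = 1 + 2 * t * (v \<bullet> w) + t\<^sup>2 * (w \<bullet> w)"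
        using vv by (simp add: inner_simps power2_eq_square inner_commute[of w v] algebra_simps)
      show ?thesis using le unfolding e1 e2 by (simp add: c_def algebra_simps)
    qed
    \<comment> \<open>Moving from \<open>v\<close> by \<open>- u *\<^sub>R w\<close> with a small \<open>u > 0\<close> would push the form below its minimum;
      this \<open>u\<close> is small enough because \<open>u * c < w \<bullet> w\<close>.\<close>
    define u where "u = (w \<bullet> w) / (c + 1)"
    have u: "0 < u" "u * (c + 1) = w \<bullet> w" using pos c0 by (auto simp: u_def)
    have "0 \<le> u * (u * c - 2 * (w \<bullet> w))"
      using ineq[of "- u"] by (simp add: power2_eq_square algebra_simps)
    then have "2 * (w \<bullet> w) \<le> u * c" using u(1) by (simp add: zero_le_mult_iff)
    then show False using u pos by (simp add: algebra_simps)
  qed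
  then have "f v = l *\<^sub>R v" by (simp add: w_def)
  with vS v1 bound show thesis using that by blast
qed

text \<open>
  Split off one eigenvector: its orthogonal complement in \<open>S\<close> is invariant because \<open>f\<close> is symmetric,
  and has smaller dimension.
\<close>

lemma orthonormal_eigenbasis_exists:
  fixes f :: "'a::euclidean_space \<Rightarrow> 'a"
  assumes f: "linear f" and sym: "\<And>x y. f x \<bullet> y = x \<bullet> f y"
    and S: "subspace S" "f ` S \<subseteq> S"
  shows "\<exists>B l. finite B \<and> span B = S \<and> (\<forall>b\<in>B. f b = l b *\<^sub>R b) \<and>
    (\<forall>a\<in>B. \<forall>b\<in>B. a \<bullet> b = (if a = b then 1 else 0))"
  using S
proof (induction "dim S" arbitrary: S rule: less_induct)
  case less
  show ?case
  proof (cases "S = {0}")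
    case True
    then show ?thesis by (intro exI[of _ "{}"]) auto
  next
    case False
    obtain v l where v: "v \<in> S" "norm v = 1" "f v = l *\<^sub>R v"
      using self_adjoint_least_eigenvalue[OF f sym less.prems False] by blast
    have vv: "v \<bullet> v = 1" using v(2) by (simp add: dot_square_norm)
    define T where "T = {x \<in> S. x \<bullet> v = 0}"
    have T: "subspace T" using less.prems(1) by (auto simp: T_def subspace_def inner_simps)
    have fT: "f ` T \<subseteq> T" using less.prems(2) v(3) by (auto simp: T_def sym)
    have "v \<notin> T" using vv by (simp add: T_def)
    moreover have "T \<subseteq> S" by (auto simp: T_def)
    ultimately have "T \<subset> S" using v(1) by blast
    then have "dim T < dim S"
      using dim_psubset[of T S] T less.prems(1) by (simp add: span_eq_iff[THEN iffD2])
    from less.hyps[OF this T fT] obtain B l' where B: "finite B" "span B = T"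
      "\<And>b. b \<in> B \<Longrightarrow> f b = l' b *\<^sub>R b" "\<And>a b. a \<in> B \<Longrightarrow> b \<in> B \<Longrightarrow> a \<bullet> b = (if a = b then 1 else 0)"
      by blast
    have BT: "B \<subseteq> T" using B(2) span_superset by blast
    have "v \<notin> B" using BT \<open>v \<notin> T\<close> by auto
    have orth: "b \<bullet> v = 0" "v \<bullet> b = 0" if "b \<in> B" for b
      using BT that by (auto simp: T_def inner_commute)
    have "span (insert v B) = S"
    proof
      show "span (insert v B) \<subseteq> S"
        using BT v(1) less.prems(1) by (intro span_minimal) (auto simp: T_def)
      show "S \<subseteq> span (insert v B)"
      proof
        fix x assume x: "x \<in> S"
        have "x - (x \<bullet> v) *\<^sub>R v \<in> T"
          using x v(1) vv less.prems(1) by (auto simp: T_def inner_simps subspace_diff subspace_scale)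
        then show "x \<in> span (insert v B)"
          using B(2) by (auto simp: span_breakdown_eq)
      qed
    qed
    then show ?thesis
      using B v orth vv \<open>v \<notin> B\<close>
      by (intro exI[of _ "insert v B"] exI[of _ "l'(v := l)"]) auto
  qed
qed

text \<open>
  From \<open>(S + m) (S - m) v = 0\<close> and the injectivity of \<open>S + m\<close>. This determines a positive operator from
  its square on the eigenvectors of the square, which yields uniqueness of square roots.
\<close>

lemma square_eigenvector:
  fixes S :: "'a::euclidean_space \<Rightarrow> 'a"
  assumes S: "linear S" and pos: "\<And>x. x \<noteq> 0 \<Longrightarrow> 0 < S x \<bullet> x"
    and "0 \<le> m" and v: "S (S v) = (m * m) *\<^sub>R v"
  shows "S v = m *\<^sub>R v"
proof (rule ccontr)
  assume "S v \<noteq> m *\<^sub>R v"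
  define w where "w = S v - m *\<^sub>R v"
  have "S w = - m *\<^sub>R w"
    by (simp add: w_def linear_diff[OF S] linear_scale[OF S] v algebra_simps)
  moreover have "w \<noteq> 0" using \<open>S v \<noteq> m *\<^sub>R v\<close> by (simp add: w_def)
  ultimately have "0 < - m * (w \<bullet> w)" using pos[of w] by simp
  then show False using \<open>0 \<le> m\<close> inner_ge_zero[of w] by (auto simp: mult_less_0_iff)
qed

lemma positive_square_root_exists:
  fixes f :: "'a::euclidean_space \<Rightarrow> 'a"
  assumes f: "linear f" and sym: "\<And>x y. f x \<bullet> y = x \<bullet> f y" and pos: "\<And>x. x \<noteq> 0 \<Longrightarrow> 0 < f x \<bullet> x"
  obtains S where "linear S" "\<And>x y. S x \<bullet> y = x \<bullet> S y" "\<And>x. x \<noteq> 0 \<Longrightarrow> 0 < S x \<bullet> x"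
    "\<And>x. S (S x) = f x"
proof -
  obtain B l where B: "finite B" "span B = UNIV" and ev: "\<And>b. b \<in> B \<Longrightarrow> f b = l b *\<^sub>R b"
    and on: "\<And>a b. a \<in> B \<Longrightarrow> b \<in> B \<Longrightarrow> a \<bullet> b = (if a = b then 1 else 0)"
    using orthonormal_eigenbasis_exists[OF f sym subspace_UNIV subset_UNIV] by blast
  have lpos: "0 < l b" if b: "b \<in> B" for b
  proof -
    have "b \<bullet> b = 1" using on[OF b b] by simp
    moreover from this have "b \<noteq> 0" by auto
    ultimately show ?thesis using pos[of b] ev[OF b] by simp
  qed
  define S where "S x = (\<Sum>b\<in>B. (sqrt (l b) * (x \<bullet> b)) *\<^sub>R b)" for x
  have S: "linear S"
    by (rule linearI)
      (simp_all add: S_def inner_simps algebra_simps sum.distrib scaleR_sum_right)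
  have Sb: "S b = sqrt (l b) *\<^sub>R b" if b: "b \<in> B" for b
  proof -
    have "S b = (\<Sum>a\<in>B. if a = b then sqrt (l b) *\<^sub>R b else 0)"
      unfolding S_def using b on by (intro sum.cong) auto
    then show ?thesis using B b by simp
  qed
  have form: "S x \<bullet> y = (\<Sum>b\<in>B. sqrt (l b) * (x \<bullet> b) * (y \<bullet> b))" for x y
    by (simp add: S_def inner_sum_left inner_commute[of y])
  have "S x \<bullet> y = x \<bullet> S y" for x y
    using form[of x y] form[of y x] by (simp add: inner_commute mult_ac)
  moreover have "0 < S x \<bullet> x" if "x \<noteq> 0" for x
  proof -
    have "\<exists>b\<in>B. x \<bullet> b \<noteq> 0"
    proof (rule ccontr)
      assume "\<not> ?thesis"
      then have "orthogonal x y" if "y \<in> span B" for y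
        using that by (intro orthogonal_to_span[of y B x]) (auto simp: orthogonal_def)
      then show False using B(2) \<open>x \<noteq> 0\<close> by (metis UNIV_I orthogonal_self)
    qed
    then obtain b where "b \<in> B" "x \<bullet> b \<noteq> 0" by blast
    then have "0 < sqrt (l b) * (x \<bullet> b)\<^sup>2" using lpos by simp
    moreover have "sqrt (l b) * (x \<bullet> b)\<^sup>2 \<le> (\<Sum>b\<in>B. sqrt (l b) * (x \<bullet> b)\<^sup>2)"
      using lpos B(1) \<open>b \<in> B\<close> by (intro member_le_sum) (auto simp: less_imp_le)
    ultimately show ?thesis by (simp add: form power2_eq_square mult.assoc)
  qed
  moreover have "S (S x) = f x" for x
  proof (rule linear_eq_on_span[of "S \<circ> S" f B, unfolded o_def])
    show "linear (\<lambda>x. S (S x))" using linear_compose[OF S S] by (simp add: o_def)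
    show "S (S b) = f b" if "b \<in> B" for b
      using that lpos[OF that] by (simp add: Sb linear_scale[OF S] ev)
    show "x \<in> span B" using B(2) by simp
  qed (rule f)
  ultimately show thesis using that[of S] S by blast
qed

text \<open>
  On an eigenbasis of \<open>S\<close> the operator \<open>T\<close> is determined by \<open>square_eigenvector\<close>.
\<close>

lemma positive_square_root_unique:
  fixes S T :: "'a::euclidean_space \<Rightarrow> 'a"
  assumes S: "linear S" "\<And>x y. S x \<bullet> y = x \<bullet> S y" "\<And>x. x \<noteq> 0 \<Longrightarrow> 0 < S x \<bullet> x"
    and T: "linear T" "\<And>x. x \<noteq> 0 \<Longrightarrow> 0 < T x \<bullet> x"
    and eq: "\<And>x. S (S x) = T (T x)"
  shows "S = T"
proof
  fix x
  obtain B l where B: "span B = UNIV" and ev: "\<forall>b\<in>B. S b = l b *\<^sub>R b"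
    and on: "\<forall>a\<in>B. \<forall>b\<in>B. a \<bullet> b = (if a = b then 1 else 0)"
    using orthonormal_eigenbasis_exists[OF S(1,2) subspace_UNIV subset_UNIV] by blast
  show "S x = T x"
  proof (rule linear_eq_on_span[of S T B])
    fix b assume b: "b \<in> B"
    have "b \<bullet> b = 1" using on b by auto
    then have "0 < l b" using S(3)[of b] ev b by fastforce
    moreover have "T (T b) = (l b * l b) *\<^sub>R b"
      using eq[of b] ev b by (simp add: linear_scale[OF S(1)])
    ultimately show "S b = T b"
      using square_eigenvector[OF T, of "l b" b] ev b by simp
  qed (use B S T in auto)
qed

section \<open>Positive definite matrices and the real inner product\<close>

lemma inner_complex_vec: "(x::complex^'n) \<bullet> y = Re (\<Sum>i\<in>UNIV. x $ i * cnj (y $ i))"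
  by (simp add: inner_vec_def inner_complex_def)

lemma inner_conj_transpose: "(M *v x) \<bullet> y = x \<bullet> (conj_transpose M *v y)"
proof -
  have "(\<Sum>i\<in>UNIV. (M *v x) $ i * cnj (y $ i)) = (\<Sum>i\<in>UNIV. \<Sum>j\<in>UNIV. M $ i $ j * x $ j * cnj (y $ i))"
    by (simp add: matrix_vector_mult_def sum_distrib_right)
  also have "\<dots> = (\<Sum>j\<in>UNIV. \<Sum>i\<in>UNIV. M $ i $ j * x $ j * cnj (y $ i))"
    by (rule sum.swap)
  also have "\<dots> = (\<Sum>j\<in>UNIV. x $ j * cnj ((conj_transpose M *v y) $ j))"
    by (simp add: matrix_vector_mult_def conj_transpose_def sum_distrib_left mult_ac)
  finally show ?thesis by (simp add: inner_complex_vec)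
qed

lemma self_adjoint_matrix_iff_inner:
  "self_adjoint_matrix M \<longleftrightarrow> (\<forall>x y. (M *v x) \<bullet> y = x \<bullet> (M *v y))"
proof
  assume "\<forall>x y. (M *v x) \<bullet> y = x \<bullet> (M *v y)"
  then have "conj_transpose M *v y = M *v y" for y
    by (metis inner_conj_transpose vector_eq_ldot)
  then show "self_adjoint_matrix M" by (simp add: self_adjoint_matrix_def matrix_eq)
qed (simp add: self_adjoint_matrix_def inner_conj_transpose)

text \<open>
  With \<open>d = \<i>\<close> the real inner product also detects the imaginary part of an eigenvalue.
\<close>

lemma inner_scaled: "(c *s v) \<bullet> (d *s v) = Re (c * cnj d) * (v \<bullet> (v::complex^'n))"
proof -
  have "(\<Sum>i\<in>UNIV. (c *s v) $ i * cnj ((d *s v) $ i)) = (c * cnj d) * (\<Sum>i\<in>UNIV. of_real ((cmod (v $ i))\<^sup>2))"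
    by (simp add: sum_distrib_left complex_norm_square mult_ac del: of_real_power)
  moreover have "(v \<bullet> v) = (\<Sum>i\<in>UNIV. (cmod (v $ i))\<^sup>2)"
    by (simp add: inner_vec_def power2_norm_eq_inner)
  ultimately show ?thesis
    by (simp only: inner_complex_vec[of "c *s v"] of_real_sum[symmetric]) simp
qed

lemma of_real_smult: "complex_of_real r *s v = r *\<^sub>R (v::complex^'n)"
  by (simp add: vec_eq_iff complex_eq_iff)

lemma smult_scaleR: "c *s (r *\<^sub>R v) = r *\<^sub>R (c *s (v::complex^'n))"
  by (simp add: vec_eq_iff)

lemma matrix_vector_mult_smult: "M *v (c *s v) = c *s (M *v (v::complex^'n))"
  by (simp add: vec_eq_iff matrix_vector_mult_def sum_distrib_left mult_ac)

text \<open>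
  One direction uses that the least value of the form on the unit sphere is an eigenvalue. In the
  other, an eigenvalue \<open>c\<close> is real because the inner products of \<open>M v = c v\<close> with \<open>\<i> v\<close>, and of \<open>v\<close>
  with \<open>M (\<i> v) = \<i> c v\<close>, agree but equal \<open>v \<bullet> v\<close> times \<open>Im c\<close> and \<open>- Im c\<close>, respectively.
\<close>

lemma positive_definite_iff_form:
  fixes M :: "complex^'n^'n"
  shows "positive_definite M \<longleftrightarrow> self_adjoint_matrix M \<and> (\<forall>v. v \<noteq> 0 \<longrightarrow> 0 < (M *v v) \<bullet> v)"
proof (intro iffI conjI allI impI)
  assume pd: "positive_definite M"
  then show sa: "self_adjoint_matrix M" by (simp add: positive_definite_def)
  fix v :: "complex^'n" assume "v \<noteq> 0"
  then have ne: "(UNIV :: (complex^'n) set) \<noteq> {0}" by blast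
  obtain w l where w: "norm w = 1" "M *v w = l *\<^sub>R w"
    and min: "\<And>x. l * (x \<bullet> x) \<le> (M *v x) \<bullet> x"
    using self_adjoint_least_eigenvalue[OF matrix_vector_mul_linear
        sa[unfolded self_adjoint_matrix_iff_inner, rule_format] subspace_UNIV subset_UNIV ne]
    by (metis UNIV_I)
  have "matrix_eigenvalue M (of_real l)"
    unfolding matrix_eigenvalue_def using w by (intro exI[of _ w]) (auto simp: of_real_smult)
  then have "0 < l" using pd by (auto simp: positive_definite_def)
  then show "0 < (M *v v) \<bullet> v" using min[of v] \<open>v \<noteq> 0\<close>
    by (smt (verit) inner_gt_zero_iff mult_pos_pos)
next
  assume r: "self_adjoint_matrix M \<and> (\<forall>v. v \<noteq> 0 \<longrightarrow> 0 < (M *v v) \<bullet> v)"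
  show "positive_definite M" unfolding positive_definite_def
  proof (intro conjI allI impI)
    show sa: "self_adjoint_matrix M" using r by blast
    fix c assume "matrix_eigenvalue M c"
    then obtain v where v: "v \<noteq> 0" "M *v v = c *s v" by (auto simp: matrix_eigenvalue_def)
    have vv: "v \<bullet> v > 0" using v by simp
    have "(M *v v) \<bullet> (\<i> *s v) = v \<bullet> (M *v (\<i> *s v))"
      using sa self_adjoint_matrix_iff_inner by blast
    then have "(c *s v) \<bullet> (\<i> *s v) = (1 *s v) \<bullet> ((\<i> * c) *s v)"
      by (simp add: matrix_vector_mult_smult v)
    then have "Im c = 0" using vv unfolding inner_scaled by simp
    then show "c \<in> \<real>" by (simp add: complex_is_Real_iff)
    have "0 < (c *s v) \<bullet> (1 *s v)" using r v by auto
    then show "0 < Re c" using vv unfolding inner_scaled by (simp add: zero_less_mult_iff)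
  qed
qed

lemma positive_definite_inner:
  assumes "positive_definite M"
  shows "(M *v x) \<bullet> y = x \<bullet> (M *v y)" "x \<noteq> 0 \<Longrightarrow> 0 < (M *v x) \<bullet> x"
  using assms by (auto simp: positive_definite_iff_form self_adjoint_matrix_iff_inner)

lemma positive_definiteI:
  assumes "\<And>x y. (M *v x) \<bullet> y = x \<bullet> (M *v y)" "\<And>x. x \<noteq> 0 \<Longrightarrow> 0 < (M *v x) \<bullet> x"
  shows "positive_definite M"
  using assms by (auto simp: positive_definite_iff_form self_adjoint_matrix_iff_inner)

section \<open>Square roots of positive definite matrices\<close>

lemma complex_linear_is_matrix:
  fixes S :: "complex^'n \<Rightarrow> complex^'n"
  assumes S: "linear S" and i: "\<And>v. S (\<i> *s v) = \<i> *s S v"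
  shows "matrix S *v v = S v"
proof (rule matrix_works)
  have dec: "c *s v = Re c *\<^sub>R v + Im c *\<^sub>R (\<i> *s v)" for c and v :: "complex^'n"
    by (simp add: vec_eq_iff complex_eq_iff)
  have "S (c *s v) = c *s S v" for c v
    by (subst (1 2) dec) (simp add: linear_add[OF S] linear_scale[OF S] i)
  then show "Vector_Spaces.linear (*s) (*s) S"
    by (simp add: Vector_Spaces.linear_iff linear_add[OF S] vec.vector_space_axioms)
qed

text \<open>
  The square root \<open>S\<close> from the real spectral theorem is only real-linear a priori. But \<open>-\<i> S \<i>\<close> is another
  positive square root of \<open>M\<close>, so it equals \<open>S\<close> by uniqueness; hence \<open>S\<close> commutes with \<open>\<i>\<close> and is
  given by a complex matrix.
\<close>

lemma matrix_sqrt: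
  assumes "positive_definite M"
  shows "positive_definite (matrix_sqrt M)" "matrix_sqrt M ** matrix_sqrt M = M"
proof -
  note M = positive_definite_inner[OF assms]
  obtain S where S: "linear S" "\<And>x y. S x \<bullet> y = x \<bullet> S y" "\<And>x. x \<noteq> 0 \<Longrightarrow> 0 < S x \<bullet> x"
    "\<And>x. S (S x) = M *v x"
    using positive_square_root_exists[of "(*v) M"] M by auto
  define T where "T x = - \<i> *s S (\<i> *s x)" for x
  have T: "linear T"
    by (rule linearI)
      (simp_all add: T_def vector_add_ldistrib linear_add[OF S(1)] smult_scaleR linear_scale[OF S(1)])
  have ii: "(- \<i> *s u) \<bullet> v = u \<bullet> (\<i> *s v)" for u v :: "complex^'n"
    by (simp add: inner_vec_def inner_complex_def)
  have "S = T"
  proof (rule positive_square_root_unique[OF S(1-3) T])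
    show "0 < T x \<bullet> x" if "x \<noteq> 0" for x
      unfolding T_def ii using S(3)[of "\<i> *s x"] that by simp
    show "S (S x) = T (T x)" for x
      by (simp add: T_def S(4) vector_smult_assoc matrix_vector_mult_smult)
  qed
  then have "S (\<i> *s v) = \<i> *s S v" for v
    by (metis (no_types, lifting) T_def vector_smult_assoc mult_minus_right i_squared minus_minus
        vector_smult_lid power2_eq_square mult_minus1_right power2_i)
  then have mS: "matrix S *v v = S v" for v by (rule complex_linear_is_matrix[OF S(1)])
  have *: "positive_definite (matrix S)" using S by (intro positive_definiteI) (auto simp: mS)
  have **: "matrix S ** matrix S = M"
    by (simp add: matrix_eq mS S(4) flip: matrix_vector_mul_assoc)
  have unique: "N = matrix S" if N: "positive_definite N \<and> N ** N = M" for N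
  proof -
    have "(*v) (matrix S) = (*v) N"
      by (rule positive_square_root_unique[OF matrix_vector_mul_linear positive_definite_inner[OF *]
            matrix_vector_mul_linear positive_definite_inner(2)])
        (use N ** in \<open>simp_all add: matrix_vector_mul_assoc\<close>)
    then show ?thesis by (simp add: matrix_eq)
  qed
  have "positive_definite (matrix_sqrt M) \<and> matrix_sqrt M ** matrix_sqrt M = M"
    unfolding matrix_sqrt_def by (rule theI[of _ "matrix S"]) (use * ** unique in blast)+
  then show "positive_definite (matrix_sqrt M)" "matrix_sqrt M ** matrix_sqrt M = M" by auto
qed

section \<open>Bounding the operator norm by a trace\<close>

text \<open>
  The norm of a matrix, taken as a vector of vectors, is its Frobenius norm.
\<close>

lemma norm_matrix_vector_mult_le: "norm (N *v x) \<le> norm N * norm (x :: complex^'n)"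
proof -
  have "norm ((N *v x) $ i) \<le> norm (N $ i) * norm x" for i
  proof -
    have "norm ((N *v x) $ i) \<le> (\<Sum>j\<in>UNIV. \<bar>cmod (N $ i $ j)\<bar> * \<bar>cmod (x $ j)\<bar>)"
      by (simp add: matrix_vector_mult_def sum_norm_le norm_mult)
    also have "\<dots> \<le> norm (N $ i) * norm x"
      unfolding norm_vec_def by (rule L2_set_mult_ineq)
    finally show ?thesis .
  qed
  then have "norm (N *v x) \<le> L2_set (\<lambda>i. norm (N $ i) * norm x) UNIV"
    unfolding norm_vec_def[of "N *v x"] by (intro L2_set_mono) auto
  also have "\<dots> = norm N * norm x"
    by (simp add: L2_set_left_distrib norm_vec_def[of N])
  finally show ?thesis .
qed

lemma power2_norm_eq_trace: "(norm (N :: complex^'n^'n))\<^sup>2 = Re (trace (conj_transpose N ** N))"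
proof -
  have "(norm N)\<^sup>2 = (\<Sum>i\<in>UNIV. \<Sum>j\<in>UNIV. (cmod (N $ i $ j))\<^sup>2)"
    by (simp add: norm_vec_def L2_set_def sum_nonneg)
  also have "\<dots> = (\<Sum>j\<in>UNIV. \<Sum>i\<in>UNIV. (cmod (N $ i $ j))\<^sup>2)" by (rule sum.swap)
  also have "\<dots> = Re (trace (conj_transpose N ** N))"
    by (simp add: trace_def matrix_matrix_mult_def conj_transpose_def cmod_power2 flip: power2_eq_square)
  finally show ?thesis .
qed

lemma conj_transpose_mult: "conj_transpose (M ** N) = conj_transpose N ** conj_transpose M"
  by (simp add: conj_transpose_def matrix_matrix_mult_def vec_eq_iff mult.commute)

text \<open>
  The squared Frobenius norm of \<open>P\<^sup>1\<^sup>/\<^sup>2 Q\<^sup>1\<^sup>/\<^sup>2\<close> is \<open>trace (Q\<^sup>1\<^sup>/\<^sup>2 P Q\<^sup>1\<^sup>/\<^sup>2) = trace (P Q)\<close>. The square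
  roots disappear, so that only entries of the averages themselves have to be estimated.
\<close>

lemma operator_norm_sqrt_product_le:
  assumes P: "positive_definite P" and Q: "positive_definite Q"
  shows "(operator_norm (matrix_sqrt P ** matrix_sqrt Q))\<^sup>2 \<le>
    (\<Sum>i\<in>UNIV. \<Sum>j\<in>UNIV. cmod (P $ i $ j) * cmod (Q $ j $ i))"
proof -
  let ?p = "matrix_sqrt P" and ?q = "matrix_sqrt Q"
  have sa: "conj_transpose ?p = ?p" "conj_transpose ?q = ?q"
    using matrix_sqrt(1)[OF P] matrix_sqrt(1)[OF Q]
    by (auto simp: positive_definite_def self_adjoint_matrix_def)
  have "operator_norm (?p ** ?q) \<le> norm (?p ** ?q)"
    unfolding operator_norm_def by (intro onorm_le norm_matrix_vector_mult_le)
  moreover have "0 \<le> operator_norm (?p ** ?q)"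
    unfolding operator_norm_def
    by (intro onorm_pos_le linear_conv_bounded_linear[THEN iffD1] matrix_vector_mul_linear)
  ultimately have "(operator_norm (?p ** ?q))\<^sup>2 \<le> (norm (?p ** ?q))\<^sup>2"
    by (intro power_mono)
  also have "\<dots> = Re (trace ((?q ** P) ** ?q))"
    unfolding power2_norm_eq_trace conj_transpose_mult sa
    by (metis matrix_mul_assoc matrix_sqrt(2)[OF P])
  also have "\<dots> = Re (trace (P ** Q))"
    by (metis matrix_mul_assoc matrix_sqrt(2)[OF Q] trace_mul_sym)
  also have "\<dots> \<le> cmod (trace (P ** Q))" by (rule complex_Re_le_cmod)
  also have "\<dots> \<le> (\<Sum>i\<in>UNIV. \<Sum>j\<in>UNIV. cmod (P $ i $ j) * cmod (Q $ j $ i))"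
    unfolding trace_def matrix_matrix_mult_def
    by (auto intro!: sum_norm_le simp: norm_mult)
  finally show ?thesis .
qed

section \<open>Entries, inverses and scalings of positive definite matrices\<close>

lemma positive_definite_Cauchy_Schwarz:
  assumes M: "positive_definite M"
  shows "((M *v x) \<bullet> y)\<^sup>2 \<le> ((M *v x) \<bullet> x) * ((M *v y) \<bullet> y)"
proof (cases "y = 0")
  case False
  define a where "a = (M *v y) \<bullet> y"
  define b where "b = (M *v x) \<bullet> y"
  have a: "0 < a" unfolding a_def by (rule positive_definite_inner(2)[OF M False])
  have b': "(M *v y) \<bullet> x = b"
    using positive_definite_inner(1)[OF M, of y x] by (simp add: b_def inner_commute[of y])
  \<comment> \<open>Up to the factor \<open>a\<close>, this is the part of \<open>x\<close> orthogonal to \<open>y\<close> for the form of \<open>M\<close>.\<close>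
  let ?z = "a *\<^sub>R x - b *\<^sub>R y"
  have "0 \<le> (M *v ?z) \<bullet> ?z"
    using positive_definite_inner(2)[OF M, of ?z] by (cases "?z = 0") auto
  also have "\<dots> = a * a * ((M *v x) \<bullet> x) - a * b * ((M *v x) \<bullet> y)
      - a * b * ((M *v y) \<bullet> x) + b * b * ((M *v y) \<bullet> y)"
    by (simp add: linear_diff[OF matrix_vector_mul_linear] linear_scale[OF matrix_vector_mul_linear]
        inner_diff_left inner_diff_right algebra_simps)
  also have "\<dots> = a * (a * ((M *v x) \<bullet> x) - b\<^sup>2)"
    unfolding b' b_def[symmetric] a_def[symmetric] by (simp add: power2_eq_square algebra_simps)
  finally show ?thesis using a by (simp add: zero_le_mult_iff a_def b_def mult.commute)
qed simp

lemma invertible_positive_definite: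
  assumes "positive_definite M" shows "invertible M"
proof -
  have "M *v x = 0 \<longrightarrow> x = 0" for x
    using positive_definite_inner(2)[OF assms, of x] by (metis inner_zero_left less_irrefl)
  then show ?thesis by (simp add: invertible_left_inverse matrix_left_invertible_ker)
qed

lemma matrix_inv_mult:
  assumes "invertible M"
  shows "M ** matrix_inv M = mat 1" "matrix_inv M ** M = mat 1"
  using assms unfolding invertible_def matrix_inv_def
  by (rule someI2_ex; blast)+

lemma matrix_inv_eqI:
  fixes M N :: "complex^'n^'n"
  assumes "M ** N = mat 1" shows "matrix_inv M = N"
  unfolding matrix_inv_def
  using assms matrix_left_right_inverse[of M N]
  by (intro some_equality) (auto, metis matrix_mul_assoc matrix_mul_lid matrix_mul_rid)

lemma positive_definite_matrix_inv:
  assumes M: "positive_definite M" shows "positive_definite (matrix_inv M)"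
proof (rule positive_definiteI)
  have inv: "M *v (matrix_inv M *v x) = x" for x
    by (simp add: matrix_vector_mul_assoc matrix_inv_mult[OF invertible_positive_definite[OF M]])
  show "(matrix_inv M *v x) \<bullet> y = x \<bullet> (matrix_inv M *v y)" for x y
    by (metis inv positive_definite_inner(1)[OF M])
  show "0 < (matrix_inv M *v x) \<bullet> x" if "x \<noteq> 0" for x
  proof -
    have "matrix_inv M *v x \<noteq> 0" using inv[of x] that by auto
    then show ?thesis
      using positive_definite_inner(2)[OF M, of "matrix_inv M *v x"] by (simp add: inv inner_commute)
  qed
qed

lemma mult_axis_inner: "(M *v axis i c) \<bullet> axis j d = Re (M $ j $ i * c * cnj d)"
proof -
  have "(M *v axis i c) $ j = M $ j $ i * c"
    by (simp add: matrix_vector_mult_def axis_def if_distrib cong: if_cong)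
  then show ?thesis by (simp add: inner_axis inner_complex_def)
qed

lemma positive_definite_diag:
  assumes "positive_definite M"
  shows "0 < Re (M $ i $ i)"
  using positive_definite_inner(2)[OF assms, of "axis i 1"] by (simp add: mult_axis_inner axis_eq_0_iff)

text \<open>
  Cauchy-Schwarz for two coordinate vectors; one is multiplied by the phase of the entry, so that
  the real inner product sees its modulus.
\<close>

lemma positive_definite_entry_le:
  assumes M: "positive_definite M"
  shows "(cmod (M $ i $ j))\<^sup>2 \<le> Re (M $ i $ i) * Re (M $ j $ j)"
proof -
  define c where "c = sgn (M $ i $ j)"
  have c: "M $ i $ j * cnj c = cmod (M $ i $ j)"
    by (simp add: c_def sgn_eq complex_norm_square[symmetric] power2_eq_square)
  have cc: "Re (M $ i $ i * c * cnj c) \<le> Re (M $ i $ i)"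
    using positive_definite_diag[OF M, of i]
    by (cases "M $ i $ j = 0") (simp_all add: c_def mult.assoc complex_norm_square[symmetric] norm_sgn)
  have "(cmod (M $ i $ j))\<^sup>2 \<le> Re (M $ j $ j) * Re (M $ i $ i * c * cnj c)"
    using positive_definite_Cauchy_Schwarz[OF M, of "axis j 1" "axis i c"]
    by (simp only: mult_axis_inner mult_1_right c Re_complex_of_real complex_cnj_one)
  also have "\<dots> \<le> Re (M $ j $ j) * Re (M $ i $ i)"
    using cc positive_definite_diag[OF M, of j] by (intro mult_left_mono) auto
  finally show ?thesis by (simp add: mult.commute)
qed

text \<open>
  Cauchy-Schwarz for \<open>u = M\<inverse> e\<^sub>i\<close> and \<open>e\<^sub>i\<close>, where \<open>M u\<close> has inner product \<open>1\<close> with \<open>e\<^sub>i\<close>.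
\<close>

lemma matrix_inv_diag_ge:
  assumes M: "positive_definite M"
  shows "1 / Re (M $ i $ i) \<le> Re (matrix_inv M $ i $ i)"
proof -
  let ?e = "axis i 1" and ?u = "matrix_inv M *v axis i 1"
  have Mu: "M *v ?u = ?e"
    by (simp add: matrix_vector_mul_assoc matrix_inv_mult[OF invertible_positive_definite[OF M]])
  have "((M *v ?u) \<bullet> ?e)\<^sup>2 \<le> ((M *v ?u) \<bullet> ?u) * ((M *v ?e) \<bullet> ?e)"
    by (rule positive_definite_Cauchy_Schwarz[OF M])
  then have "1 \<le> (?u \<bullet> ?e) * ((M *v ?e) \<bullet> ?e)"
    unfolding Mu by (simp add: inner_commute inner_axis_axis inner_complex_def)
  then show ?thesis using positive_definite_diag[OF M, of i]
    by (simp add: mult_axis_inner field_simps)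
qed

lemma positive_definite_scaling:
  fixes M :: "complex^'n^'n" and d :: "'n \<Rightarrow> real"
  assumes M: "positive_definite M" and d: "\<And>i. d i \<noteq> 0"
  shows "positive_definite (\<chi> i j. of_real (d i) * M $ i $ j * of_real (d j))"
    and "matrix_inv (\<chi> i j. of_real (d i) * M $ i $ j * of_real (d j)) =
      (\<chi> i j. matrix_inv M $ i $ j / of_real (d i * d j))"
proof -
  let ?N = "\<chi> i j. of_real (d i) * M $ i $ j * of_real (d j)"
  let ?D = "\<lambda>v :: complex^'n. \<chi> i. of_real (d i) * v $ i"
  have N: "?N *v v = ?D (M *v ?D v)" for v
    by (simp add: vec_eq_iff matrix_vector_mult_def sum_distrib_left mult_ac)
  have D: "?D v \<bullet> w = v \<bullet> ?D w" for v w
    by (simp add: inner_vec_def inner_complex_def algebra_simps)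
  show "positive_definite ?N"
  proof (rule positive_definiteI)
    show "(?N *v x) \<bullet> y = x \<bullet> (?N *v y)" for x y
      unfolding N by (metis D positive_definite_inner(1)[OF M])
    show "0 < (?N *v x) \<bullet> x" if "x \<noteq> 0" for x
    proof -
      have "?D x \<noteq> 0" using that d by (auto simp: vec_eq_iff)
      then show ?thesis unfolding N D by (rule positive_definite_inner(2)[OF M])
    qed
  qed
  show "matrix_inv ?N = (\<chi> i j. matrix_inv M $ i $ j / of_real (d i * d j))"
  proof (rule matrix_inv_eqI)
    have "(\<Sum>k\<in>UNIV. of_real (d i) * M $ i $ k * of_real (d k) * (matrix_inv M $ k $ j / of_real (d k * d j)))
        = of_real (d i / d j) * (M ** matrix_inv M) $ i $ j" for i j
      unfolding matrix_matrix_mult_def using d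
      by (simp add: sum_distrib_left field_simps)
    then show "?N ** (\<chi> i j. matrix_inv M $ i $ j / of_real (d i * d j)) = mat 1"
      using d by (simp add: vec_eq_iff matrix_matrix_mult_def[of ?N] mat_def
          matrix_inv_mult[OF invertible_positive_definite[OF M]])
  qed
qed

section \<open>Powers of the absolute value on the real line\<close>

lemma AE_lebesgue_obtain_between:
  fixes a b :: real
  assumes "AE x in lebesgue. P x" "a < b"
  obtains x where "a < x" "x < b" "P x"
proof -
  obtain N where N: "N \<in> null_sets lebesgue" "{x. \<not> P x} \<subseteq> N"
    using assms(1) by (auto simp: eventually_ae_filter)
  then have "negligible {x. \<not> P x}"
    by (meson negligible_iff_null_sets negligible_subset)
  moreover have "\<not> negligible {a<..<b}" using assms(2) by (simp add: open_not_negligible)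
  ultimately have "\<not> {a<..<b} \<subseteq> {x. \<not> P x}" using negligible_subset by blast
  then show thesis using that by auto
qed

lemma AE_lebesgue_neq_0: "AE x::real in lebesgue. x \<noteq> 0"
  by (rule AE_completion[OF AE_lborel_singleton])

text \<open>
  A nonzero power is unbounded near infinity or near \<open>0\<close>, on a set of positive measure in either case.
\<close>

lemma bounded_abs_powr_exponent_eq_0:
  assumes "AE x::real in lebesgue. \<bar>x\<bar> powr \<delta> \<le> K"
  shows "\<delta> = 0"
proof (rule ccontr)
  assume "\<delta> \<noteq> 0"
  \<comment> \<open>The power exceeds \<open>K\<close> from \<open>s\<close> on to the right or to the left, according to the sign of \<open>\<delta>\<close>.\<close>
  define s where "s = (\<bar>K\<bar> + 1) powr (1 / \<delta>)"
  have s: "0 < s" "s powr \<delta> = \<bar>K\<bar> + 1" using \<open>\<delta> \<noteq> 0\<close> by (auto simp: s_def powr_powr)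
  show False
  proof (cases "0 < \<delta>")
    case True
    obtain x where x: "s < x" "\<bar>x\<bar> powr \<delta> \<le> K"
      using AE_lebesgue_obtain_between[OF assms, of s "s + 1"] by auto
    have "s powr \<delta> < x powr \<delta>" using s x True by (intro powr_less_mono2) auto
    then show False using s x by auto
  next
    case False
    obtain x where x: "s / 2 < x" "x < s" "\<bar>x\<bar> powr \<delta> \<le> K"
      using AE_lebesgue_obtain_between[OF assms, of "s / 2" s] s by auto
    have "s powr \<delta> < x powr \<delta>" using s x False \<open>\<delta> \<noteq> 0\<close> by (intro powr_less_mono2_neg) auto
    then show False using s x by auto
  qed
qed

lemma has_integral_abs_powr:
  assumes g: "-1 < g" and c: "0 \<le> c"
  shows "((\<lambda>x::real. \<bar>x\<bar> powr g) has_integral 2 * (c powr (g + 1) / (g + 1))) {-c..c}"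
proof -
  have r: "((\<lambda>x::real. \<bar>x\<bar> powr g) has_integral (c powr (g + 1) / (g + 1))) {0..c}"
    by (rule has_integral_eq[OF _ has_integral_powr_from_0[OF g c]]) auto
  have "((\<lambda>x::real. \<bar>x\<bar> powr g) has_integral (c powr (g + 1) / (g + 1))) {-c..0}"
    using has_integral_reflect_real[of "\<lambda>x::real. \<bar>x\<bar> powr g" "c powr (g + 1) / (g + 1)" c 0] r by simp
  from has_integral_combine[OF _ _ this r] c show ?thesis by simp
qed

lemma abs_powr_absolutely_integrable:
  assumes "-1 < g" "bounded S" "S \<in> sets lebesgue"
  shows "(\<lambda>x::real. \<bar>x\<bar> powr g) absolutely_integrable_on S"
proof -
  obtain c where c: "0 < c" "\<And>x. x \<in> S \<Longrightarrow> norm x \<le> c"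
    using assms(2) bounded_pos by blast
  have "(\<lambda>x::real. \<bar>x\<bar> powr g) absolutely_integrable_on {-c..c}"
    using has_integral_abs_powr[OF assms(1), of c] c
    by (intro nonnegative_absolutely_integrable_1) (auto simp: integrable_on_def)
  then show ?thesis
    by (rule set_integrable_subset) (use assms c in force)+
qed

text \<open>
  If \<open>g \<le> -1\<close>, the function dominates \<open>1 / x\<close>, whose integral over \<open>{e..1}\<close> is \<open>- ln e\<close> and exceeds any
  bound.
\<close>

lemma exponent_gt_of_abs_powr_integrable:
  assumes int: "(\<lambda>x::real. \<bar>x\<bar> powr g) absolutely_integrable_on {0..1}"
  shows "-1 < g"
proof (rule ccontr)
  assume "\<not> -1 < g"
  have i: "(\<lambda>x::real. \<bar>x\<bar> powr g) integrable_on {0..1}"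
    using int by (rule set_lebesgue_integral_eq_integral)
  define C where "C = integral {0..1} (\<lambda>x::real. \<bar>x\<bar> powr g)"
  have C: "0 \<le> C" unfolding C_def by (rule integral_nonneg[OF i]) simp
  define e where "e = exp (- C - 1)"
  have e: "0 < e" "e \<le> 1" using C by (auto simp: e_def)
  have ln: "((\<lambda>x. 1 / x) has_integral (ln 1 - ln e)) {e..1}"
    using e by (intro fundamental_theorem_of_calculus)
      (auto intro!: derivative_eq_intros simp: has_real_derivative_iff_has_vector_derivative[symmetric])
  have "C + 1 = integral {e..1} (\<lambda>x. 1 / x)"
    using integral_unique[OF ln] by (simp add: e_def)
  also have "\<dots> \<le> integral {e..1} (\<lambda>x::real. \<bar>x\<bar> powr g)"
  proof (rule integral_le)
    show "(\<lambda>x. 1 / x) integrable_on {e..1}" using ln by (auto simp: integrable_on_def)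
    show "(\<lambda>x::real. \<bar>x\<bar> powr g) integrable_on {e..1}"
      using integrable_on_subinterval[OF i] e by auto
    show "1 / x \<le> \<bar>x\<bar> powr g" if "x \<in> {e..1}" for x
    proof -
      have "x powr (-1) \<le> x powr g"
        using that e \<open>\<not> -1 < g\<close> by (intro powr_mono') auto
      then show ?thesis using that e by (simp add: powr_minus_divide)
    qed
  qed
  also have "\<dots> \<le> C" unfolding C_def
    using e i integrable_on_subinterval[OF i, of e 1] by (intro integral_subset_le) auto
  finally show False by simp
qed

text \<open>
  The form in which integrability of the entries of \<open>W\<close> and of its inverse constrains the powers.
\<close>

lemma exponent_gt_of_locally_integrable_majorant:
  assumes f: "locally_integrable f" and le: "AE x in lebesgue. \<bar>x\<bar> powr g \<le> c * cmod (f x)"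
  shows "-1 < g"
proof (rule exponent_gt_of_abs_powr_integrable)
  have "f absolutely_integrable_on {0..1}" using f by (simp add: locally_integrable_def)
  then have "set_integrable lebesgue {0..1} (\<lambda>x. c * cmod (f x))"
    by (intro set_integrable_mult_right set_integrable_norm)
  moreover have "set_borel_measurable lebesgue {0..1} (\<lambda>x::real. \<bar>x\<bar> powr g)"
    unfolding set_borel_measurable_def by (intro measurable_completion) simp
  moreover have "AE x in lebesgue. x \<in> {0..1} \<longrightarrow> norm (\<bar>x\<bar> powr g) \<le> norm (c * cmod (f x))"
    using le by eventually_elim auto
  ultimately show "(\<lambda>x::real. \<bar>x\<bar> powr g) absolutely_integrable_on {0..1}"
    by (rule set_integrable_bound)
qed

section \<open>The scalar condition for power weights\<close>

lemma bounded_interval_lmeasurable: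
  assumes "I \<in> bounded_intervals"
  shows "I \<in> sets lebesgue" "I \<in> lmeasurable" "bounded I" "0 < measure lebesgue I"
  using assms measurable_convex[of I]
  by (auto simp: bounded_intervals_def is_interval_convex_1 fmeasurableD)

lemma bounded_interval_diff_le:
  assumes I: "I \<in> bounded_intervals" and "x \<in> I" "y \<in> I"
  shows "\<bar>x - y\<bar> \<le> measure lebesgue I"
proof -
  have "closed_segment x y \<subseteq> I"
    using assms by (simp add: bounded_intervals_def is_interval_convex_1 closed_segment_subset)
  then have "measure lebesgue (closed_segment x y) \<le> measure lebesgue I"
    using bounded_interval_lmeasurable[OF I]
    by (intro measure_mono_fmeasurable) (auto simp: closed_segment_eq_real_ivl)
  then show ?thesis by (simp add: closed_segment_eq_real_ivl split: if_splits)
qed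

definition power_average :: "real \<Rightarrow> real set \<Rightarrow> real" where
  "power_average g I = (LINT x:I|lebesgue. \<bar>x\<bar> powr g) / measure lebesgue I"

lemma power_average_nonneg: "0 \<le> power_average g I"
  unfolding power_average_def set_lebesgue_integral_def
  by (intro divide_nonneg_nonneg Bochner_Integration.integral_nonneg) auto

lemma power_average_le_const:
  assumes g: "-1 < g" and I: "I \<in> bounded_intervals" and le: "\<And>x. x \<in> I \<Longrightarrow> \<bar>x\<bar> powr g \<le> c"
  shows "power_average g I \<le> c"
proof -
  note I = bounded_interval_lmeasurable[OF I]
  have "(LINT x:I|lebesgue. \<bar>x\<bar> powr g) \<le> (LINT x:I|lebesgue. c)"
    using I le abs_powr_absolutely_integrable[OF g] by (intro set_integral_mono) auto
  also have "\<dots> = c * measure lebesgue I"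
    using I by (simp add: set_lebesgue_integral_def)
  finally show ?thesis using I by (simp add: power_average_def field_simps)
qed

lemma power_average_le_centered:
  assumes g: "-1 < g" and I: "I \<in> bounded_intervals" and c: "0 \<le> c" "I \<subseteq> {-c..c}"
  shows "power_average g I \<le> 2 * c powr (g + 1) / (g + 1) / measure lebesgue I"
proof -
  note I = bounded_interval_lmeasurable[OF I]
  have i: "(\<lambda>x::real. \<bar>x\<bar> powr g) absolutely_integrable_on I"
    "(\<lambda>x::real. \<bar>x\<bar> powr g) absolutely_integrable_on {-c..c}"
    using abs_powr_absolutely_integrable[OF g] I by auto
  note e = set_lebesgue_integral_eq_integral[OF i(1)] set_lebesgue_integral_eq_integral[OF i(2)]
  have "integral I (\<lambda>x::real. \<bar>x\<bar> powr g) \<le> integral {-c..c} (\<lambda>x::real. \<bar>x\<bar> powr g)"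
    using e c by (intro integral_subset_le) auto
  also have "\<dots> = 2 * c powr (g + 1) / (g + 1)"
    using integral_unique[OF has_integral_abs_powr[OF g c(1)]] by simp
  finally show ?thesis using I by (simp add: power_average_def e divide_right_mono del: divide_divide_eq_left)
qed

text \<open>
  An interval of length \<open>L\<close> that reaches farther than \<open>2 L\<close> from the origin sees an essentially constant
  weight: \<open>\<bar>x\<bar>\<close> varies there by a factor of at most \<open>3\<close>. Otherwise it lies in \<open>{- 2 L..2 L}\<close>, and the
  integrals over that interval are explicit and scale correctly.
\<close>

lemma power_average_product_le:
  assumes g: "-1 < g" "g < 1" and I: "I \<in> bounded_intervals"
  shows "power_average g I * power_average (- g) I \<le> 9 + 16 / ((1 + g) * (1 - g))"
proof -
  let ?L = "measure lebesgue I"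
  have L: "0 < ?L" using bounded_interval_lmeasurable[OF I] by simp
  have g': "0 < 16 / ((1 + g) * (1 - g))" using g by simp
  show ?thesis
  proof (cases "\<exists>y\<in>I. 2 * ?L < \<bar>y\<bar>")
    case True
    then obtain y where y: "y \<in> I" "2 * ?L < \<bar>y\<bar>" by blast
    define m where "m = \<bar>y\<bar> / 2"
    have m: "0 < m" using y L by (simp add: m_def)
    have le: "power_average h I \<le> 3 * m powr h" if h: "-1 < h" "h < 1" for h
    proof (rule power_average_le_const[OF h(1) I])
      fix x assume "x \<in> I"
      then have "\<bar>x - y\<bar> \<le> ?L" by (rule bounded_interval_diff_le[OF I _ y(1)])
      then have x: "m \<le> \<bar>x\<bar>" "\<bar>x\<bar> \<le> 3 * m" using y by (auto simp: m_def)
      \<comment> \<open>The ratio lies in \<open>{1..3}\<close>, so any power \<open>h \<le> 1\<close> of it is at most \<open>3\<close>.\<close>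
      have "(\<bar>x\<bar> / m) powr h \<le> (\<bar>x\<bar> / m) powr 1"
        using x m h by (intro powr_mono) auto
      also have "\<dots> \<le> 3" using x m by (simp add: field_simps)
      finally show "\<bar>x\<bar> powr h \<le> 3 * m powr h"
        using m by (simp add: powr_divide field_simps)
    qed
    have "power_average g I * power_average (- g) I \<le> (3 * m powr g) * (3 * m powr (- g))"
      using le[of g] le[of "- g"] g by (intro mult_mono power_average_nonneg) auto
    also have "\<dots> = 9" using m by (simp add: powr_minus)
    finally show ?thesis using g' by linarith
  next
    case False
    then have sub: "I \<subseteq> {- (2 * ?L)..2 * ?L}" by (auto simp: abs_le_iff not_less)
    have "power_average g I * power_average (- g) I \<le>
        (2 * (2 * ?L) powr (g + 1) / (g + 1) / ?L) * (2 * (2 * ?L) powr (- g + 1) / (- g + 1) / ?L)"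
      using g L by (intro mult_mono power_average_nonneg power_average_le_centered[OF _ I _ sub]) auto
    also have "\<dots> = 4 * ((2 * ?L) powr (g + 1) * (2 * ?L) powr (- g + 1)) / ((1 + g) * (1 - g)) / ?L\<^sup>2"
      by (simp add: power2_eq_square add.commute)
    also have "(2 * ?L) powr (g + 1) * (2 * ?L) powr (- g + 1) = (2 * ?L)\<^sup>2"
      using L by (simp flip: powr_add)
    also have "4 * (2 * ?L)\<^sup>2 / ((1 + g) * (1 - g)) / ?L\<^sup>2 = 16 / ((1 + g) * (1 - g))"
      using L by (simp add: power2_eq_square)
    finally show ?thesis by simp
  qed
qed

section \<open>Averages of matrix weights\<close>

lemma matrix_weight_set_integrable:
  assumes W: "matrix_weight W" and I: "I \<in> bounded_intervals"
  shows "set_integrable lebesgue I (\<lambda>x. W x $ i $ j)"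
proof -
  note I = bounded_interval_lmeasurable[OF I]
  have "(\<lambda>x. W x $ i $ j) absolutely_integrable_on closure I"
    using W I by (simp add: matrix_weight_def locally_integrable_def compact_closure)
  then show ?thesis by (rule set_integrable_subset) (use I closure_subset in auto)
qed

text \<open>
  Averaging commutes with the forms \<open>M \<mapsto> (M *v v) \<bullet> w\<close>, which transfers symmetry and positivity from
  the values of a weight to its averages.
\<close>

lemma matrix_average_form:
  assumes W: "matrix_weight W" and I: "I \<in> bounded_intervals"
  shows "has_bochner_integral lebesgue (\<lambda>x. indicator I x * ((W x *v v) \<bullet> w))
    (measure lebesgue I * ((matrix_average W I *v v) \<bullet> w))"
proof -
  let ?X = "\<lambda>i j. LINT x:I|lebesgue. W x $ i $ j" and ?L = "measure lebesgue I"
  have L: "0 < ?L" using bounded_interval_lmeasurable[OF I] by simp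
  have "has_bochner_integral lebesgue (\<lambda>x. indicator I x *\<^sub>R W x $ i $ j) (?X i j)" for i j
    using matrix_weight_set_integrable[OF W I, of i j]
    by (simp add: set_integrable_def set_lebesgue_integral_def has_bochner_integral_integrable)
  then have "has_bochner_integral lebesgue
      (\<lambda>x. Re (\<Sum>i\<in>UNIV. (\<Sum>j\<in>UNIV. (indicator I x *\<^sub>R W x $ i $ j) * v $ j) * cnj (w $ i)))
      (Re (\<Sum>i\<in>UNIV. (\<Sum>j\<in>UNIV. ?X i j * v $ j) * cnj (w $ i)))"
    by (intro has_bochner_integral_bounded_linear[OF bounded_linear_Re] has_bochner_integral_sum
        has_bochner_integral_mult_left) auto
  moreover have "Re (\<Sum>i\<in>UNIV. (\<Sum>j\<in>UNIV. (indicator I x *\<^sub>R W x $ i $ j) * v $ j) * cnj (w $ i)) =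
      indicator I x * ((W x *v v) \<bullet> w)" for x
    by (simp add: inner_complex_vec matrix_vector_mult_def indicator_def)
  moreover have "Re (\<Sum>i\<in>UNIV. (\<Sum>j\<in>UNIV. ?X i j * v $ j) * cnj (w $ i)) =
      ?L * ((matrix_average W I *v v) \<bullet> w)"
  proof -
    have "(\<Sum>i\<in>UNIV. (\<Sum>j\<in>UNIV. ?X i j * v $ j) * cnj (w $ i)) =
        of_real ?L * (\<Sum>i\<in>UNIV. (matrix_average W I *v v) $ i * cnj (w $ i))"
      using L by (simp add: matrix_vector_mult_def matrix_average_def sum_distrib_left sum_distrib_right)
    then show ?thesis by (simp add: inner_complex_vec)
  qed
  ultimately show ?thesis by simp
qed

lemma positive_definite_matrix_average:
  assumes W: "matrix_weight W" and I: "I \<in> bounded_intervals"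
  shows "positive_definite (matrix_average W I)"
proof (rule positive_definiteI)
  let ?L = "measure lebesgue I"
  have L: "0 < ?L" and Is: "I \<in> sets lebesgue" using bounded_interval_lmeasurable[OF I] by auto
  have pd: "AE x in lebesgue. positive_definite (W x)" using W by (simp add: matrix_weight_def)
  note form = matrix_average_form[OF W I]
  show "(matrix_average W I *v v) \<bullet> w = v \<bullet> (matrix_average W I *v w)" for v w
  proof -
    have "AE x in lebesgue. indicator I x * ((W x *v v) \<bullet> w) = indicator I x * ((W x *v w) \<bullet> v)"
      using pd by eventually_elim (simp add: positive_definite_inner(1)[of _ v w] inner_commute[of v])
    then have "(\<integral>x. indicator I x * ((W x *v v) \<bullet> w) \<partial>lebesgue) = (\<integral>x. indicator I x * ((W x *v w) \<bullet> v) \<partial>lebesgue)"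
      using form by (intro integral_cong_AE) (auto simp: has_bochner_integral_iff)
    then show ?thesis
      using form[of v w] form[of w v] L by (simp add: has_bochner_integral_iff inner_commute)
  qed
  show "0 < (matrix_average W I *v v) \<bullet> v" if "v \<noteq> 0" for v
  proof -
    let ?f = "\<lambda>x. indicator I x * ((W x *v v) \<bullet> v)"
    have pos: "AE x in lebesgue. 0 < (W x *v v) \<bullet> v"
      using pd by eventually_elim (rule positive_definite_inner(2)[OF _ that])
    then have nn: "AE x in lebesgue. 0 \<le> ?f x" by eventually_elim simp
    have "integral\<^sup>L lebesgue ?f \<noteq> 0"
    proof
      assume "integral\<^sup>L lebesgue ?f = 0"
      then have "AE x in lebesgue. ?f x = 0"
        using integral_nonneg_eq_0_iff_AE[OF _ nn] form by (auto simp: has_bochner_integral_iff)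
      with pos have "AE x in lebesgue. x \<notin> I"
        by eventually_elim (auto simp: indicator_def)
      then have "emeasure lebesgue I = 0"
        using Is by (simp add: AE_iff_measurable[of I])
      then show False using L by (simp add: measure_def)
    qed
    moreover have "0 \<le> integral\<^sup>L lebesgue ?f" by (rule integral_nonneg_AE[OF nn])
    ultimately have "0 < integral\<^sup>L lebesgue ?f" by simp
    then have "0 < ?L * ((matrix_average W I *v v) \<bullet> v)"
      using form[of v v] by (simp add: has_bochner_integral_iff)
    then show ?thesis using L by (simp add: zero_less_mult_iff)
  qed
qed

section \<open>Matrix power functions\<close>

lemma type1_entry:
  assumes "type1_matrix_power_function A \<gamma> W" "x \<noteq> 0"
  shows "W x $ i $ j = A $ i $ j * of_real (\<bar>x\<bar> powr (\<gamma> $ i $ j))"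
  using assms by (simp add: type1_matrix_power_function_def)

lemma type1_locally_integrable:
  assumes T: "type1_matrix_power_function A \<gamma> W" and g: "-1 < \<gamma> $ i $ j"
  shows "locally_integrable (\<lambda>x. W x $ i $ j)"
  unfolding locally_integrable_def
proof (intro allI impI)
  fix K :: "real set" assume "compact K"
  then have "(\<lambda>x. \<bar>x\<bar> powr (\<gamma> $ i $ j)) absolutely_integrable_on K"
    by (intro abs_powr_absolutely_integrable[OF g] compact_imp_bounded lmeasurable_compact[THEN fmeasurableD])
  then have "(\<lambda>x. A $ i $ j * of_real (\<bar>x\<bar> powr (\<gamma> $ i $ j))) absolutely_integrable_on K"
    using absolutely_integrable_linear[where h = "\<lambda>r. A $ i $ j * of_real r"]
    by (simp add: o_def bounded_linear_const_mult[OF bounded_linear_of_real])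
  then show "(\<lambda>x. W x $ i $ j) absolutely_integrable_on K"
    by (rule absolutely_integrable_spike[of _ _ "{0}"]) (use type1_entry[OF T] in auto)
qed

lemma type1_matrix_average:
  assumes T: "type1_matrix_power_function A \<gamma> W" and I: "I \<in> bounded_intervals"
  shows "matrix_average W I $ i $ j = A $ i $ j * of_real (power_average (\<gamma> $ i $ j) I)"
proof -
  let ?f = "\<lambda>x. A $ i $ j * of_real (\<bar>x\<bar> powr (\<gamma> $ i $ j))"
  have meas: "?f \<in> borel_measurable lebesgue"
    by (intro measurable_completion) simp
  have ae: "AE x in lebesgue. ?f x = W x $ i $ j"
    using AE_lebesgue_neq_0 by eventually_elim (simp add: type1_entry[OF T])
  have meas': "(\<lambda>x. W x $ i $ j) \<in> borel_measurable lebesgue"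
    by (rule borel_measurable_AE[OF meas ae])
  have "(LINT x:I|lebesgue. W x $ i $ j) = (LINT x:I|lebesgue. ?f x)"
    using ae bounded_interval_lmeasurable[OF I] meas meas' by (intro set_lebesgue_integral_cong_AE) auto
  also have "\<dots> = A $ i $ j * of_real (LINT x:I|lebesgue. \<bar>x\<bar> powr (\<gamma> $ i $ j))"
    by (simp only: set_integral_mult_right set_integral_complex_of_real)
  finally show ?thesis by (simp add: matrix_average_def power_average_def)
qed

lemma type1_eq_scaling:
  assumes T: "type1_matrix_power_function A \<gamma> W"
    and mean: "\<And>i j. \<gamma> $ i $ j = (\<gamma> $ i $ i + \<gamma> $ j $ j) / 2" and "x \<noteq> 0"
  shows "W x = (\<chi> i j. of_real (\<bar>x\<bar> powr (\<gamma> $ i $ i / 2)) * A $ i $ j * of_real (\<bar>x\<bar> powr (\<gamma> $ j $ j / 2)))"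
proof -
  have "W x $ i $ j = A $ i $ j * of_real (\<bar>x\<bar> powr (\<gamma> $ i $ i / 2) * \<bar>x\<bar> powr (\<gamma> $ j $ j / 2))" for i j
    using type1_entry[OF T \<open>x \<noteq> 0\<close>, of i j] mean[of i j] by (simp add: add_divide_distrib flip: powr_add)
  then show ?thesis by (simp add: vec_eq_iff mult_ac)
qed

lemma type1_positive_definite:
  assumes "type1_matrix_power_function A \<gamma> W" "positive_definite A"
    and "\<And>i j. \<gamma> $ i $ j = (\<gamma> $ i $ i + \<gamma> $ j $ j) / 2" and "x \<noteq> 0"
  shows "positive_definite (W x)"
  unfolding type1_eq_scaling[OF assms(1,3,4)]
  using assms(2,4) by (intro positive_definite_scaling) auto

lemma type1_matrix_inv:
  assumes T: "type1_matrix_power_function A \<gamma> W" and A: "positive_definite A"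
    and mean: "\<And>i j. \<gamma> $ i $ j = (\<gamma> $ i $ i + \<gamma> $ j $ j) / 2"
  shows "type1_matrix_power_function (matrix_inv A) (- \<gamma>) (\<lambda>x. matrix_inv (W x))"
proof -
  have "matrix_inv (W x) $ i $ j = matrix_inv A $ i $ j * of_real (\<bar>x\<bar> powr (- \<gamma> $ i $ j))"
    if x: "x \<noteq> 0" for x i j
  proof -
    have "matrix_inv (W x) $ i $ j =
        matrix_inv A $ i $ j / of_real (\<bar>x\<bar> powr (\<gamma> $ i $ i / 2) * \<bar>x\<bar> powr (\<gamma> $ j $ j / 2))"
      unfolding type1_eq_scaling[OF T mean x]
      by (subst positive_definite_scaling(2)[OF A]) (use x in auto)
    also have "\<bar>x\<bar> powr (\<gamma> $ i $ i / 2) * \<bar>x\<bar> powr (\<gamma> $ j $ j / 2) = \<bar>x\<bar> powr (\<gamma> $ i $ j)"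
      unfolding mean[of i j] by (simp add: add_divide_distrib powr_add)
    finally show ?thesis by (simp add: powr_minus_divide)
  qed
  moreover have "(- \<gamma>) $ i $ j = ((- \<gamma>) $ i $ i + (- \<gamma>) $ j $ j) / 2" for i j
    using mean[of i j] by simp
  ultimately show ?thesis
    unfolding type1_matrix_power_function_def by (metis vector_uminus_component)
qed

lemma type1_matrix_weight:
  assumes T: "type1_matrix_power_function A \<gamma> W" and A: "positive_definite A"
    and mean: "\<And>i j. \<gamma> $ i $ j = (\<gamma> $ i $ i + \<gamma> $ j $ j) / 2" and gt: "\<And>i. -1 < \<gamma> $ i $ i"
  shows "matrix_weight W"
proof -
  have "AE x in lebesgue. positive_definite (W x)"
    using AE_lebesgue_neq_0 by eventually_elim (rule type1_positive_definite[OF T A mean])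
  moreover have "-1 < \<gamma> $ i $ j" for i j
    using gt[of i] gt[of j] mean[of i j] by simp
  ultimately show ?thesis
    using type1_locally_integrable[OF T] by (simp add: matrix_weight_def)
qed

text \<open>
  The entries \<open>(i, j)\<close> of \<open>W\<close> and \<open>(j, i)\<close> of its inverse carry opposite powers, so the trace bound
  only involves products controlled by the scalar condition.
\<close>

lemma type1_A2_sufficient:
  assumes T: "type1_matrix_power_function A \<gamma> W" and A: "positive_definite A"
    and mean: "\<And>i j. \<gamma> $ i $ j = (\<gamma> $ i $ i + \<gamma> $ j $ j) / 2"
    and gt: "\<And>i. -1 < \<gamma> $ i $ i" and lt: "\<And>i. \<gamma> $ i $ i < 1"
  shows "A2_matrix_weight W"
proof -
  let ?V = "\<lambda>x. matrix_inv (W x)" and ?B = "matrix_inv A"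
  have TV: "type1_matrix_power_function ?B (- \<gamma>) ?V" by (rule type1_matrix_inv[OF T A mean])
  have W: "matrix_weight W" by (rule type1_matrix_weight[OF T A mean gt])
  have V: "matrix_weight ?V"
  proof (rule type1_matrix_weight[OF TV positive_definite_matrix_inv[OF A]])
    show "(- \<gamma>) $ i $ j = ((- \<gamma>) $ i $ i + (- \<gamma>) $ j $ j) / 2" for i j
      using mean[of i j] by simp
    show "- 1 < (- \<gamma>) $ i $ i" for i using lt[of i] by simp
  qed
  define C where "C = (\<Sum>i\<in>UNIV. \<Sum>j\<in>UNIV. cmod (A $ i $ j) * cmod (?B $ j $ i) *
    (9 + 16 / ((1 + \<gamma> $ i $ j) * (1 - \<gamma> $ i $ j))))"
  have bound: "(operator_norm (matrix_sqrt (matrix_average W I) ** matrix_sqrt (matrix_average ?V I)))\<^sup>2 \<le> C"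
    if I: "I \<in> bounded_intervals" for I
  proof -
    have "cmod (matrix_average W I $ i $ j) * cmod (matrix_average ?V I $ j $ i) \<le>
        cmod (A $ i $ j) * cmod (?B $ j $ i) * (9 + 16 / ((1 + \<gamma> $ i $ j) * (1 - \<gamma> $ i $ j)))" for i j
    proof -
      have g: "-1 < \<gamma> $ i $ j" "\<gamma> $ i $ j < 1" "\<gamma> $ j $ i = \<gamma> $ i $ j"
        using gt[of i] gt[of j] lt[of i] lt[of j] mean[of i j] mean[of j i] by simp_all
      have "cmod (matrix_average W I $ i $ j) * cmod (matrix_average ?V I $ j $ i) =
          cmod (A $ i $ j) * cmod (?B $ j $ i) *
            (power_average (\<gamma> $ i $ j) I * power_average (- \<gamma> $ i $ j) I)"
        by (simp add: type1_matrix_average[OF T I] type1_matrix_average[OF TV I] norm_mult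
            power_average_nonneg g(3))
      also have "\<dots> \<le> cmod (A $ i $ j) * cmod (?B $ j $ i) *
          (9 + 16 / ((1 + \<gamma> $ i $ j) * (1 - \<gamma> $ i $ j)))"
        by (intro mult_left_mono power_average_product_le[OF g(1,2) I]) auto
      finally show ?thesis .
    qed
    then have "(\<Sum>i\<in>UNIV. \<Sum>j\<in>UNIV. cmod (matrix_average W I $ i $ j) * cmod (matrix_average ?V I $ j $ i)) \<le> C"
      unfolding C_def by (intro sum_mono)
    then show ?thesis
      using operator_norm_sqrt_product_le[OF positive_definite_matrix_average[OF W I]
          positive_definite_matrix_average[OF V I]] by (rule order_trans[rotated])
  qed
  have "A2_characteristic W \<le> ennreal C"
    unfolding A2_characteristic_def by (intro SUP_least ennreal_leI bound)
  also have "\<dots> < \<infinity>" by simp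
  finally show ?thesis using W V by (simp add: A2_matrix_weight_def matrix_weight_def)
qed

text \<open>
  Pointwise positivity determines the powers off the diagonal, and local integrability of \<open>W\<close> and of its
  inverse bounds those on it. Then \<open>A\<close> is a scaling of the value of \<open>W\<close> at any nonzero point where that
  value is positive definite.
\<close>

lemma type1_A2_necessary:
  assumes T: "type1_matrix_power_function A \<gamma> W" and W: "A2_matrix_weight W"
  shows "positive_definite A" "\<gamma> $ i $ j = (\<gamma> $ i $ i + \<gamma> $ j $ j) / 2"
    "-1 < \<gamma> $ i $ i" "\<gamma> $ i $ i < 1"
proof -
  have loc: "\<And>i j. locally_integrable (\<lambda>x. W x $ i $ j)"
    "\<And>i j. locally_integrable (\<lambda>x. matrix_inv (W x) $ i $ j)"
    using W by (auto simp: A2_matrix_weight_def matrix_weight_def)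
  have pd: "AE x in lebesgue. positive_definite (W x) \<and> x \<noteq> 0"
    using W AE_lebesgue_neq_0 by (simp add: A2_matrix_weight_def matrix_weight_def)
  obtain z where z: "positive_definite (W z)" "z \<noteq> 0"
    using AE_lebesgue_obtain_between[OF pd, of 0 1] by auto
  have diag: "Re (W x $ i $ i) = Re (A $ i $ i) * \<bar>x\<bar> powr (\<gamma> $ i $ i)" if "x \<noteq> 0" for x i
    using type1_entry[OF T that, of i i] by simp
  have Apos: "0 < Re (A $ i $ i)" for i
    using positive_definite_diag[OF z(1), of i] diag[OF z(2), of i] z(2) by (simp add: zero_less_mult_iff)
  have mean: "\<gamma> $ i $ j = (\<gamma> $ i $ i + \<gamma> $ j $ j) / 2" for i j
  proof (cases "A $ i $ j = 0")
    case True
    then show ?thesis using T by (simp add: type1_matrix_power_function_def)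
  next
    case False
    define K where "K = Re (A $ i $ i) * Re (A $ j $ j) / (cmod (A $ i $ j))\<^sup>2"
    have "AE x in lebesgue. \<bar>x\<bar> powr (2 * \<gamma> $ i $ j - (\<gamma> $ i $ i + \<gamma> $ j $ j)) \<le> K"
      using pd
    proof eventually_elim
      case (elim x)
      then have x: "0 < \<bar>x\<bar>" by simp
      have "(cmod (A $ i $ j))\<^sup>2 * (\<bar>x\<bar> powr (\<gamma> $ i $ j))\<^sup>2 \<le>
          Re (A $ i $ i) * Re (A $ j $ j) * (\<bar>x\<bar> powr (\<gamma> $ i $ i) * \<bar>x\<bar> powr (\<gamma> $ j $ j))"
        using positive_definite_entry_le[of "W x" i j] elim
        by (simp add: diag type1_entry[OF T, of x i j] norm_mult power_mult_distrib mult_ac)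
      moreover have "(\<bar>x\<bar> powr (\<gamma> $ i $ j))\<^sup>2 = \<bar>x\<bar> powr (2 * \<gamma> $ i $ j)"
        using x by (simp add: power2_eq_square flip: powr_add)
      ultimately have "(cmod (A $ i $ j))\<^sup>2 * \<bar>x\<bar> powr (2 * \<gamma> $ i $ j) \<le>
          Re (A $ i $ i) * Re (A $ j $ j) * \<bar>x\<bar> powr (\<gamma> $ i $ i + \<gamma> $ j $ j)"
        by (simp add: powr_add)
      then show ?case using False x
        by (simp add: K_def powr_diff field_simps)
    qed
    then have "2 * \<gamma> $ i $ j - (\<gamma> $ i $ i + \<gamma> $ j $ j) = 0"
      by (rule bounded_abs_powr_exponent_eq_0)
    then show ?thesis by simp
  qed
  then show "\<gamma> $ i $ j = (\<gamma> $ i $ i + \<gamma> $ j $ j) / 2" .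
  let ?d = "\<lambda>i. \<bar>z\<bar> powr (- \<gamma> $ i $ i / 2)"
  have "A = (\<chi> i j. of_real (?d i) * W z $ i $ j * of_real (?d j))"
    unfolding type1_eq_scaling[OF T mean z(2)] using z(2)
    by (simp add: vec_eq_iff powr_minus field_simps)
  then show "positive_definite A"
    using positive_definite_scaling(1)[OF z(1), of ?d] z(2) by simp
  show "-1 < \<gamma> $ i $ i"
  proof (rule exponent_gt_of_locally_integrable_majorant[OF loc(1)])
    have "AE x::real in lebesgue. A $ i $ i \<noteq> 0" using Apos[of i] by auto
    with AE_lebesgue_neq_0
    show "AE x in lebesgue. \<bar>x\<bar> powr (\<gamma> $ i $ i) \<le> (1 / cmod (A $ i $ i)) * cmod (W x $ i $ i)"
      by eventually_elim (simp add: type1_entry[OF T] norm_mult)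
  qed
  have "-1 < - \<gamma> $ i $ i"
  proof (rule exponent_gt_of_locally_integrable_majorant[OF loc(2)])
    show "AE x in lebesgue. \<bar>x\<bar> powr (- \<gamma> $ i $ i) \<le> Re (A $ i $ i) * cmod (matrix_inv (W x) $ i $ i)"
      using pd
    proof eventually_elim
      case (elim x)
      have "1 / (Re (A $ i $ i) * \<bar>x\<bar> powr (\<gamma> $ i $ i)) \<le> Re (matrix_inv (W x) $ i $ i)"
        using matrix_inv_diag_ge[of "W x" i] elim by (simp add: diag)
      also have "\<dots> \<le> cmod (matrix_inv (W x) $ i $ i)" by (rule complex_Re_le_cmod)
      finally show ?case using Apos[of i] elim by (simp add: powr_minus_divide field_simps)
    qed
  qed
  then show "\<gamma> $ i $ i < 1" by simp
qed

theorem theorem3p3: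
  fixes A :: "complex^'n^'n" and \<gamma> :: "real^'n^'n" and W :: "real \<Rightarrow> complex^'n^'n"
  assumes "type1_matrix_power_function A \<gamma> W"
  shows "A2_matrix_weight W \<longleftrightarrow>
    positive_definite A \<and>
    (\<forall>i j. \<gamma> $ i $ j = (\<gamma> $ i $ i + \<gamma> $ j $ j) / 2 \<and> -1 < \<gamma> $ i $ i \<and> \<gamma> $ i $ i < 1)"
proof
  assume "A2_matrix_weight W"
  then show "positive_definite A \<and>
    (\<forall>i j. \<gamma> $ i $ j = (\<gamma> $ i $ i + \<gamma> $ j $ j) / 2 \<and> -1 < \<gamma> $ i $ i \<and> \<gamma> $ i $ i < 1)"
    using type1_A2_necessary[OF assms] by blast
next
  assume r: "positive_definite A \<and>
    (\<forall>i j. \<gamma> $ i $ j = (\<gamma> $ i $ i + \<gamma> $ j $ j) / 2 \<and> -1 < \<gamma> $ i $ i \<and> \<gamma> $ i $ i < 1)"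
  show "A2_matrix_weight W"
  proof (rule type1_A2_sufficient[OF assms])
    show "positive_definite A" using r by blast
    show "\<gamma> $ i $ j = (\<gamma> $ i $ i + \<gamma> $ j $ j) / 2" "-1 < \<gamma> $ i $ i" "\<gamma> $ i $ i < 1" for i j
      using r by blast+
  qed
qed

end
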